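(* If $(Z,\mathfrak{I},E)$ is a maximal soft compact space, then $(Z,\mathfrak{I},E)$ is soft $T_1$.
   Context: A soft set over $Z$ with parameter set $E$ is a pair $(Y,E)$ where $Y:E\to\mathcal{P}(Z)$ is a map. Inclusion, unions, intersections and complements of soft sets are taken parameterwise. The null soft set $\widetilde{\Phi}$ is $\emptyset$ at every $e$; the absolute soft set $\widetilde{Z}$ is $Z$ at every $e$. A soft topology on $Z$ is a collection $\mathfrak{I}$ of soft sets over $Z$ containing $\widetilde{\Phi},\widetilde{Z}$, closed under intersections of two members and under arbitrary unions; $(Z,\mathfrak{I},E)$ is then a soft topological space and members of $\mathfrak{I}$ are soft open. The space is soft compact if every family of soft open sets with union $\widetilde{Z}$ has a finite subfamily with union $\widetilde{Z}$. It is maximal soft compact if it is soft compact and no soft topology on $Z$ (with parameter set $E$) strictly containing $\mathfrak{I}$ is soft compact. For $z\in Z$, $e\in E$, the soft point $z(e)$ is the soft set equal to $\{z\}$ at $e$ and $\emptyset$ at every other parameter; $z(e)\,\widetilde{\in}\,(Y,E)$ means $z\in Y(e)$. Soft points $u(e),v(e')$ are distinct if $u\ne v$ or $e\ne e'$. The space is soft $T_1$ if for any two distinct soft points $u(e),v(e')$ there are soft open sets $(G,E),(H,E)$ with $u(e)\,\widetilde{\in}\,(G,E)$, $v(e')\,\widetilde{\notin}\,(G,E)$, $v(e')\,\widetilde{\in}\,(H,E)$, $u(e)\,\widetilde{\notin}\,(H,E)$. *)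

theory Defs
  imports Main "HOL-Library.FuncSet"
begin

text \<open>The parameter set \<open>E\<close> is fixed throughout, so a soft set \<open>(Y, E)\<close> is identified with its map
  \<open>Y\<close>. Maps \<open>E \<rightarrow> Pow Z\<close> are extensional functions, so that equality of soft sets is equality
  of HOL functions; the carriers \<open>Z\<close> and \<open>E\<close> are arbitrary, possibly empty, sets.\<close>

definition soft_sets :: "'z set \<Rightarrow> 'e set \<Rightarrow> ('e \<Rightarrow> 'z set) set" where
  "soft_sets Z E = E \<rightarrow>\<^sub>E Pow Z"

definition null_soft :: "'e set \<Rightarrow> 'e \<Rightarrow> 'z set" where
  "null_soft E = (\<lambda>e\<in>E. {})"

definition absolute_soft :: "'z set \<Rightarrow> 'e set \<Rightarrow> 'e \<Rightarrow> 'z set" where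
  "absolute_soft Z E = (\<lambda>e\<in>E. Z)"

definition soft_inter :: "'e set \<Rightarrow> ('e \<Rightarrow> 'z set) \<Rightarrow> ('e \<Rightarrow> 'z set) \<Rightarrow> 'e \<Rightarrow> 'z set" where
  "soft_inter E F G = (\<lambda>e\<in>E. F e \<inter> G e)"

definition soft_Union :: "'e set \<Rightarrow> ('e \<Rightarrow> 'z set) set \<Rightarrow> 'e \<Rightarrow> 'z set" where
  "soft_Union E \<F> = (\<lambda>e\<in>E. \<Union>F\<in>\<F>. F e)"

definition soft_topology :: "'z set \<Rightarrow> 'e set \<Rightarrow> ('e \<Rightarrow> 'z set) set \<Rightarrow> bool" where
  "soft_topology Z E \<T> \<longleftrightarrow>
     \<T> \<subseteq> soft_sets Z E \<and>
     null_soft E \<in> \<T> \<and>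
     absolute_soft Z E \<in> \<T> \<and>
     (\<forall>F\<in>\<T>. \<forall>G\<in>\<T>. soft_inter E F G \<in> \<T>) \<and>
     (\<forall>\<F>\<subseteq>\<T>. soft_Union E \<F> \<in> \<T>)"

definition soft_compact :: "'z set \<Rightarrow> 'e set \<Rightarrow> ('e \<Rightarrow> 'z set) set \<Rightarrow> bool" where
  "soft_compact Z E \<T> \<longleftrightarrow>
     (\<forall>\<F>\<subseteq>\<T>. soft_Union E \<F> = absolute_soft Z E \<longrightarrow>
        (\<exists>\<G>\<subseteq>\<F>. finite \<G> \<and> soft_Union E \<G> = absolute_soft Z E))"

definition maximal_soft_compact :: "'z set \<Rightarrow> 'e set \<Rightarrow> ('e \<Rightarrow> 'z set) set \<Rightarrow> bool" where
  "maximal_soft_compact Z E \<T> \<longleftrightarrow>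
     soft_compact Z E \<T> \<and>
     \<not> (\<exists>\<T>'. soft_topology Z E \<T>' \<and> \<T> \<subset> \<T>' \<and> soft_compact Z E \<T>')"

text \<open>The soft point \<open>z(e)\<close> is the soft set with value \<open>{z}\<close> at \<open>e\<close> and \<open>{}\<close> at the other
  parameters. Both distinctness of soft points and membership of \<open>z(e)\<close> in a soft set are
  defined in terms of the pair \<open>z\<close>, \<open>e\<close>, which is therefore what the definitions below take.\<close>

definition soft_point_in :: "'z \<Rightarrow> 'e \<Rightarrow> ('e \<Rightarrow> 'z set) \<Rightarrow> bool" where
  "soft_point_in z e Y \<longleftrightarrow> z \<in> Y e"

definition soft_T1 :: "'z set \<Rightarrow> 'e set \<Rightarrow> ('e \<Rightarrow> 'z set) set \<Rightarrow> bool" where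
  "soft_T1 Z E \<T> \<longleftrightarrow>
     (\<forall>u\<in>Z. \<forall>v\<in>Z. \<forall>e\<in>E. \<forall>e'\<in>E. u \<noteq> v \<or> e \<noteq> e' \<longrightarrow>
        (\<exists>G\<in>\<T>. \<exists>H\<in>\<T>.
           soft_point_in u e G \<and> \<not> soft_point_in v e' G \<and>
           soft_point_in v e' H \<and> \<not> soft_point_in u e H))"

end

theory Submission imports Defs begin

text \<open>A soft topology is an ordinary topology on the set of soft points, and soft compactness is
  compactness of that topology. A space is soft \<open>T\<^sub>1\<close> as soon as the complement of every soft point
  is open, so let \<open>p\<close> be a soft point and adjoin its complement to the topology. The members of the
  enlarged topology are the old open sets \<open>V\<close> and the sets \<open>V - p\<close> (lemma
  \<open>soft_topology_punctured_topology\<close>), so they differ from old open sets in \<open>p\<close> only. Replacing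
  each member of a cover by an old open set in this way and using compactness of the old topology,
  one gets a finite subfamily that covers everything except possibly \<open>p\<close>; one further member of the
  cover takes care of \<open>p\<close>. Hence the enlarged topology is again soft compact (lemma
  \<open>soft_compact_punctured_topology\<close>), and maximality says that it is not larger at all: the
  complement of \<open>p\<close> was already open.\<close>

definition puncture :: "'z \<Rightarrow> 'e \<Rightarrow> ('e \<Rightarrow> 'z set) \<Rightarrow> 'e \<Rightarrow> 'z set" where
  "puncture z e F = F(e := F e - {z})"

definition punctured_topology ::
    "'z \<Rightarrow> 'e \<Rightarrow> ('e \<Rightarrow> 'z set) set \<Rightarrow> ('e \<Rightarrow> 'z set) set" where
  "punctured_topology z e \<T> = \<T> \<union> puncture z e ` \<T>"

lemma puncture_iff: "x \<in> puncture z e F d \<longleftrightarrow> x \<in> F d \<and> \<not> (x = z \<and> d = e)"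
  by (auto simp: puncture_def)

lemma puncture_in_soft_sets: "F \<in> soft_sets Z E \<Longrightarrow> e \<in> E \<Longrightarrow> puncture z e F \<in> soft_sets Z E"
  by (auto simp: soft_sets_def puncture_def PiE_iff extensional_def)

lemma soft_inter_in_soft_sets:
  "F \<in> soft_sets Z E \<Longrightarrow> G \<in> soft_sets Z E \<Longrightarrow> soft_inter E F G \<in> soft_sets Z E"
  by (auto simp: soft_sets_def soft_inter_def PiE_iff)

lemma soft_Union_in_soft_sets: "\<F> \<subseteq> soft_sets Z E \<Longrightarrow> soft_Union E \<F> \<in> soft_sets Z E"
  by (fastforce simp: soft_sets_def soft_Union_def PiE_iff)

lemma soft_set_eqI:
  assumes "F \<in> soft_sets Z E" "G \<in> soft_sets Z E"
    and "\<And>d x. d \<in> E \<Longrightarrow> x \<in> F d \<longleftrightarrow> x \<in> G d"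
  shows "F = G"
  by (rule PiE_ext[OF assms(1,2)[unfolded soft_sets_def]]) (use assms(3) in blast)

lemma soft_Union_iff: "d \<in> E \<Longrightarrow> x \<in> soft_Union E \<F> d \<longleftrightarrow> (\<exists>F\<in>\<F>. x \<in> F d)"
  by (simp add: soft_Union_def)

lemma soft_inter_iff: "d \<in> E \<Longrightarrow> x \<in> soft_inter E F G d \<longleftrightarrow> x \<in> F d \<and> x \<in> G d"
  by (simp add: soft_inter_def)

lemma absolute_soft_iff: "d \<in> E \<Longrightarrow> x \<in> absolute_soft Z E d \<longleftrightarrow> x \<in> Z"
  by (simp add: absolute_soft_def)

lemma soft_Union_eq_absolute_iff:
  assumes "\<F> \<subseteq> soft_sets Z E"
  shows "soft_Union E \<F> = absolute_soft Z E \<longleftrightarrow> (\<forall>d\<in>E. \<forall>x\<in>Z. \<exists>F\<in>\<F>. x \<in> F d)"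
proof
  assume "soft_Union E \<F> = absolute_soft Z E"
  then show "\<forall>d\<in>E. \<forall>x\<in>Z. \<exists>F\<in>\<F>. x \<in> F d"
    by (metis soft_Union_iff absolute_soft_iff)
next
  assume cover: "\<forall>d\<in>E. \<forall>x\<in>Z. \<exists>F\<in>\<F>. x \<in> F d"
  have "\<And>F d x. F \<in> \<F> \<Longrightarrow> d \<in> E \<Longrightarrow> x \<in> F d \<Longrightarrow> x \<in> Z"
    using assms by (force simp: soft_sets_def)
  with cover show "soft_Union E \<F> = absolute_soft Z E"
    by (auto simp: soft_Union_def absolute_soft_def intro!: restrict_ext)
qed

lemma punctured_topology_subset_soft_sets:
  "\<T> \<subseteq> soft_sets Z E \<Longrightarrow> e \<in> E \<Longrightarrow> punctured_topology z e \<T> \<subseteq> soft_sets Z E"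
  by (auto simp: punctured_topology_def intro: puncture_in_soft_sets)

text \<open>A soft set squeezed between \<open>V - p\<close> and \<open>V\<close> is one of the two, so this is how membership in
  the enlarged topology is recognised without tracking which members were punctured.\<close>

lemma punctured_topologyI:
  assumes "\<T> \<subseteq> soft_sets Z E" "e \<in> E" "F \<in> soft_sets Z E" "V \<in> \<T>"
    and eq: "\<And>d x. d \<in> E \<Longrightarrow> \<not> (x = z \<and> d = e) \<Longrightarrow> x \<in> F d \<longleftrightarrow> x \<in> V d"
    and le: "z \<in> F e \<Longrightarrow> z \<in> V e"
  shows "F \<in> punctured_topology z e \<T>"
proof (cases "z \<in> F e")
  case True
  have "F = V"
  proof (rule soft_set_eqI[of _ Z E])
    show "x \<in> F d \<longleftrightarrow> x \<in> V d" if "d \<in> E" for d x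
      using eq[OF that, of x] le True by blast
  qed (use assms in auto)
  then show ?thesis using assms by (simp add: punctured_topology_def)
next
  case False
  have "F = puncture z e V"
  proof (rule soft_set_eqI[of _ Z E])
    show "x \<in> F d \<longleftrightarrow> x \<in> puncture z e V d" if "d \<in> E" for d x
      using eq[OF that, of x] False unfolding puncture_iff by blast
  qed (use assms in \<open>auto intro: puncture_in_soft_sets\<close>)
  then show ?thesis using assms by (simp add: punctured_topology_def)
qed

lemma punctured_topologyE:
  assumes "F \<in> punctured_topology z e \<T>"
  obtains V where "V \<in> \<T>" "F = V \<or> F = puncture z e V"
  using assms by (auto simp: punctured_topology_def)

lemma soft_topology_punctured_topology:
  assumes top: "soft_topology Z E \<T>" and e: "e \<in> E"
  shows "soft_topology Z E (punctured_topology z e \<T>)"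
proof -
  let ?T = "punctured_topology z e \<T>"
  have sub: "\<T> \<subseteq> soft_sets Z E"
    using top by (simp add: soft_topology_def)
  note sub' = punctured_topology_subset_soft_sets[OF sub e, of z]
  have "soft_inter E F G \<in> ?T" if F: "F \<in> ?T" and G: "G \<in> ?T" for F G
  proof -
    obtain V where V: "V \<in> \<T>" "F = V \<or> F = puncture z e V"
      using F by (rule punctured_topologyE)
    obtain W where W: "W \<in> \<T>" "G = W \<or> G = puncture z e W"
      using G by (rule punctured_topologyE)
    have "soft_inter E V W \<in> \<T>"
      using top V W by (simp add: soft_topology_def)
    moreover have "soft_inter E F G \<in> soft_sets Z E"
      using F G sub' by (blast intro: soft_inter_in_soft_sets)
    ultimately show ?thesis
      by (intro punctured_topologyI[OF sub e, of _ "soft_inter E V W"])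
        (use V W e in \<open>auto simp: soft_inter_iff puncture_iff\<close>)
  qed
  moreover have "soft_Union E \<F> \<in> ?T" if F: "\<F> \<subseteq> ?T" for \<F>
  proof -
    \<comment> \<open>Undoing the punctures changes the union at most in the soft point itself, and taking every
      possible preimage at once avoids a choice.\<close>
    let ?\<V> = "{V \<in> \<T>. V \<in> \<F> \<or> puncture z e V \<in> \<F>}"
    have "soft_Union E ?\<V> \<in> \<T>"
      using top by (simp add: soft_topology_def)
    moreover have "soft_Union E \<F> \<in> soft_sets Z E"
      using F sub' by (blast intro: soft_Union_in_soft_sets)
    moreover have lift: "\<exists>V\<in>?\<V>. x \<in> V d" if "A \<in> \<F>" "x \<in> A d" for A x d
    proof -
      obtain V where "V \<in> \<T>" "A = V \<or> A = puncture z e V"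
        using F \<open>A \<in> \<F>\<close> by (blast elim: punctured_topologyE)
      with that show ?thesis by (auto simp: puncture_iff)
    qed
    moreover have "\<exists>A\<in>\<F>. x \<in> A d" if "V \<in> ?\<V>" "x \<in> V d" "\<not> (x = z \<and> d = e)" for V x d
      using that by (metis (mono_tags, lifting) mem_Collect_eq puncture_iff)
    ultimately show ?thesis
      using e by (intro punctured_topologyI[OF sub e, of _ "soft_Union E ?\<V>"])
        (simp_all only: soft_Union_iff, blast+)
  qed
  ultimately show ?thesis
    using top sub' by (auto simp: soft_topology_def punctured_topology_def)
qed

lemma soft_compact_punctured_topology:
  assumes sub: "\<T> \<subseteq> soft_sets Z E" and compact: "soft_compact Z E \<T>"
    and z: "z \<in> Z" and e: "e \<in> E"
  shows "soft_compact Z E (punctured_topology z e \<T>)"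
  unfolding soft_compact_def
proof (intro allI impI)
  fix \<F>
  assume F: "\<F> \<subseteq> punctured_topology z e \<T>" and "soft_Union E \<F> = absolute_soft Z E"
  moreover have F': "\<F> \<subseteq> soft_sets Z E"
    using F punctured_topology_subset_soft_sets[OF sub e] by blast
  ultimately have cover: "\<exists>A\<in>\<F>. x \<in> A d" if "d \<in> E" "x \<in> Z" for d x
    using that soft_Union_eq_absolute_iff by blast
  let ?\<V> = "{V \<in> \<T>. V \<in> \<F> \<or> puncture z e V \<in> \<F>}"
  have "\<exists>V\<in>?\<V>. x \<in> V d" if d: "d \<in> E" and x: "x \<in> Z" for d x
  proof -
    obtain A where A: "A \<in> \<F>" "x \<in> A d"
      using cover[OF d x] by blast
    obtain V where "V \<in> \<T>" "A = V \<or> A = puncture z e V"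
      using F A by (blast elim: punctured_topologyE)
    with A show ?thesis by (auto simp: puncture_iff)
  qed
  moreover have V': "?\<V> \<subseteq> soft_sets Z E"
    using sub by blast
  ultimately have "soft_Union E ?\<V> = absolute_soft Z E"
    using soft_Union_eq_absolute_iff by blast
  moreover have "?\<V> \<subseteq> \<T>" by blast
  ultimately obtain \<G> where G: "\<G> \<subseteq> ?\<V>" "finite \<G>" "soft_Union E \<G> = absolute_soft Z E"
    using compact unfolding soft_compact_def by meson
  have G': "\<exists>V\<in>\<G>. x \<in> V d" if "d \<in> E" "x \<in> Z" for d x
    using that G V' soft_Union_eq_absolute_iff[of \<G> Z E] by blast
  obtain P where P: "P \<in> \<F>" "z \<in> P e"
    using cover[OF e z] by blast
  \<comment> \<open>Keep every member of the cover that comes from \<open>\<G>\<close>, punctured or not; \<open>P\<close> restores the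
    one soft point that puncturing may lose.\<close>
  let ?\<H> = "insert P (\<F> \<inter> (\<G> \<union> puncture z e ` \<G>))"
  have "\<exists>A\<in>?\<H>. x \<in> A d" if d: "d \<in> E" and x: "x \<in> Z" for d x
  proof (cases "x = z \<and> d = e")
    case True
    then show ?thesis using P by blast
  next
    case False
    obtain V where V: "V \<in> \<G>" "x \<in> V d"
      using G'[OF d x] by blast
    then have "V \<in> \<F> \<or> puncture z e V \<in> \<F>"
      using G by blast
    moreover have "x \<in> puncture z e V d"
      using V False by (simp add: puncture_iff)
    ultimately show ?thesis using V by blast
  qed
  moreover have "?\<H> \<subseteq> \<F>" using P by blast
  moreover have "finite ?\<H>" using G by simp
  ultimately show "\<exists>\<H>\<subseteq>\<F>. finite \<H> \<and> soft_Union E \<H> = absolute_soft Z E"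
    using soft_Union_eq_absolute_iff[of ?\<H> Z E] F' by (intro exI[of _ ?\<H>]) blast
qed

lemma maximal_soft_compact_point_complement_open:
  assumes top: "soft_topology Z E \<T>" and max: "maximal_soft_compact Z E \<T>"
    and z: "z \<in> Z" and e: "e \<in> E"
  shows "puncture z e (absolute_soft Z E) \<in> \<T>"
proof -
  have "soft_compact Z E (punctured_topology z e \<T>)"
    using top max z e
    by (intro soft_compact_punctured_topology)
      (auto simp: soft_topology_def maximal_soft_compact_def)
  with soft_topology_punctured_topology[OF top e, of z] max
  have "\<not> \<T> \<subset> punctured_topology z e \<T>"
    unfolding maximal_soft_compact_def by blast
  then have "punctured_topology z e \<T> = \<T>"
    by (auto simp: punctured_topology_def)
  moreover have "absolute_soft Z E \<in> \<T>"
    using top by (simp add: soft_topology_def)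
  ultimately show ?thesis
    by (auto simp: punctured_topology_def)
qed

theorem theorem3p18:
  fixes Z :: "'z set" and E :: "'e set" and \<T> :: "('e \<Rightarrow> 'z set) set"
  assumes "soft_topology Z E \<T>"
    and "maximal_soft_compact Z E \<T>"
  shows "soft_T1 Z E \<T>"
  unfolding soft_T1_def
proof (intro ballI impI)
  fix u v e e'
  assume "u \<in> Z" "v \<in> Z" "e \<in> E" "e' \<in> E" "u \<noteq> v \<or> e \<noteq> e'"
  \<comment> \<open>Each soft point has the complement of the other one as its open neighbourhood.\<close>
  then show "\<exists>G\<in>\<T>. \<exists>H\<in>\<T>. soft_point_in u e G \<and> \<not> soft_point_in v e' G \<and>
      soft_point_in v e' H \<and> \<not> soft_point_in u e H"
    by (intro bexI[of _ "puncture v e' (absolute_soft Z E)"]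
        bexI[of _ "puncture u e (absolute_soft Z E)"]
        maximal_soft_compact_point_complement_open[OF assms])
      (auto simp: soft_point_in_def puncture_iff absolute_soft_iff)
qed

end
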